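(* Let $n\ge 1$, let $Q\in\mathbb{R}^{n\times n}$, $c\in\mathbb{R}^n$, and let $l,u\in\mathbb{Z}^n$ with $l_i<u_i$ for $i=1,\ldots,n$. Let $I,J$ and $m_1,\ldots,m_n$ be the index sets and positive integers determined by $l,u$ as in the context, and let $(\widetilde{P})$ be the integer program defined in the context. For any $\theta\in\mathbb{R}^n$, $(\widetilde{P})$ is equivalent to the following linearly constrained mixed-binary quadratic program $(\mathrm{MBQP}_\theta)$, whose variables are $\widetilde{x}\in\mathbb{R}^n$, $z\in\{0,1\}^n$, and $y_{ik}\in\{0,1\}$ (for $i\in I$, $k=1,\ldots,m_i$, and for $i\in J$, $k=0,\ldots,(m_i-1)/2$): $$\min\ \ \widetilde{x}^TQ\widetilde{x}+c^T\widetilde{x}+\sum_{i\in I}\theta_i\Big(\widetilde{x}_i^2-\sum_{k=1}^{m_i}k^2y_{ik}\Big)+\sum_{i\in J}\theta_i\Big(\widetilde{x}_i^2-\sum_{k=0}^{(m_i-1)/2}(2k+1)^2y_{ik}\Big)$$ subject to, for all $i\in I$, $$-\sum_{k=1}^{m_i}k\,y_{ik}\le\widetilde{x}_i\le\sum_{k=1}^{m_i}k\,y_{ik},\qquad z_i\le\sum_{k=1}^{m_i}y_{ik}\le 1,$$ $$\sum_{k=1}^{m_i}k\,y_{ik}-\widetilde{x}_i\le 2m_iz_i,\qquad \sum_{k=1}^{m_i}k\,y_{ik}+\widetilde{x}_i\le 2m_i(1-z_i),$$ and, for all $i\in J$, $$-\sum_{k=0}^{(m_i-1)/2}(2k+1)y_{ik}\le\widetilde{x}_i\le\sum_{k=0}^{(m_i-1)/2}(2k+1)y_{ik},\qquad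 \sum_{k=0}^{(m_i-1)/2}y_{ik}=1,$$ $$\sum_{k=0}^{(m_i-1)/2}(2k+1)y_{ik}-\widetilde{x}_i\le 2m_iz_i,\qquad \sum_{k=0}^{(m_i-1)/2}(2k+1)y_{ik}+\widetilde{x}_i\le 2m_i(1-z_i).$$ The equivalence is in the sense that both optimal objective values are equal and both problems share the same optimal solutions $\widetilde{x}$: a vector $\widetilde{x}$ is an optimal solution of $(\widetilde{P})$ if and only if there exist $y,z$ such that $(\widetilde{x},y,z)$ is an optimal solution of $(\mathrm{MBQP}_\theta)$.
   Context: Given $l,u\in\mathbb{Z}^n$ with $l_i<u_i$ for all $i$, define $$I=\Big\{i\in\{1,\ldots,n\}:\ \tfrac{u_i+l_i}{2}\in\mathbb{Z}\Big\},\qquad J=\Big\{i\in\{1,\ldots,n\}:\ \tfrac{u_i+l_i}{2}\notin\mathbb{Z}\Big\},$$ $$m_i=\begin{cases}\dfrac{u_i-l_i}{2}, & i\in I,\\[1mm] u_i-l_i, & i\in J.\end{cases}$$ (Thus $m_i$ is a positive integer for every $i$, and $m_i$ is odd for $i\in J$.) The problem $(\widetilde{P})$ is $$\min\ \widetilde{x}^TQ\widetilde{x}+c^T\widetilde{x}$$ over $\widetilde{x}\in\mathbb{R}^n$ subject to $$-m_i\le\widetilde{x}_i\le m_i,\ \ \widetilde{x}_i\in\mathbb{Z}\quad\text{for all } i\in I,$$ $$-m_i\le\widetilde{x}_i\le m_i,\ \ \frac{\widetilde{x}_i-1}{2}\in\mathbb{Z}\quad\text{for all } i\in J.$$ No convexity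 of the objective (positive semidefiniteness of $Q$) is assumed. *)

theory Defs
  imports "HOL-Analysis.Analysis"
begin

definition index_I :: "int ^ 'n \<Rightarrow> int ^ 'n \<Rightarrow> 'n set" where
  "index_I l u = {i. (real_of_int (u $ i) + real_of_int (l $ i)) / 2 \<in> \<int>}"

definition index_J :: "int ^ 'n \<Rightarrow> int ^ 'n \<Rightarrow> 'n set" where
  "index_J l u = {i. (real_of_int (u $ i) + real_of_int (l $ i)) / 2 \<notin> \<int>}"

(* Natural-number valued because m bounds summation ranges.  The division is exact and
   the conversion from int loses nothing when l $ i < u $ i; see the lemmas below. *)
definition bound_m :: "int ^ 'n \<Rightarrow> int ^ 'n \<Rightarrow> 'n \<Rightarrow> nat" where
  "bound_m l u i = (if i \<in> index_I l u then nat ((u $ i - l $ i) div 2) else nat (u $ i - l $ i))"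

lemma index_I_iff_even: "i \<in> index_I l u \<longleftrightarrow> even (u $ i - l $ i)"
proof
  assume "i \<in> index_I l u"
  then obtain k :: int where "(real_of_int (u $ i) + real_of_int (l $ i)) / 2 = real_of_int k"
    unfolding index_I_def by (auto elim: Ints_cases)
  then have "real_of_int (u $ i + l $ i) = real_of_int (2 * k)" by simp
  then have "u $ i + l $ i = 2 * k" by (simp only: of_int_eq_iff)
  then show "even (u $ i - l $ i)" by presburger
next
  assume "even (u $ i - l $ i)"
  then obtain k where "u $ i + l $ i = 2 * k" by (metis dvdE even_add even_diff)
  then have "real_of_int (u $ i) + real_of_int (l $ i) = 2 * real_of_int k"
    by (metis of_int_add of_int_mult of_int_numeral)
  then show "i \<in> index_I l u" by (simp add: index_I_def)
qed

lemma bound_m_I: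
  assumes "l $ i < u $ i" "i \<in> index_I l u"
  shows "real (bound_m l u i) = (real_of_int (u $ i) - real_of_int (l $ i)) / 2" "bound_m l u i > 0"
proof -
  obtain k where k: "u $ i - l $ i = 2 * k" using assms(2) unfolding index_I_iff_even by (rule dvdE)
  then have "k > 0" using assms(1) by simp
  moreover have "real_of_int (u $ i) - real_of_int (l $ i) = 2 * real_of_int k"
    using k by (metis of_int_diff of_int_mult of_int_numeral)
  ultimately show "real (bound_m l u i) = (real_of_int (u $ i) - real_of_int (l $ i)) / 2"
    "bound_m l u i > 0"
    using k assms(2) by (simp_all add: bound_m_def)
qed

lemma bound_m_J:
  assumes "l $ i < u $ i" "i \<in> index_J l u"
  shows "real (bound_m l u i) = real_of_int (u $ i) - real_of_int (l $ i)" "odd (bound_m l u i)"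
proof -
  have "i \<notin> index_I l u" using assms(2) by (simp add: index_I_def index_J_def)
  then show "real (bound_m l u i) = real_of_int (u $ i) - real_of_int (l $ i)"
    "odd (bound_m l u i)"
    using assms(1) by (simp_all add: bound_m_def index_I_iff_even even_nat_iff)
qed

definition quad_obj :: "real ^ 'n ^ 'n \<Rightarrow> real ^ 'n \<Rightarrow> real ^ 'n \<Rightarrow> real" where
  "quad_obj Q c x = x \<bullet> (Q *v x) + c \<bullet> x"

definition P_feasible :: "int ^ 'n \<Rightarrow> int ^ 'n \<Rightarrow> (real ^ 'n) set" where
  "P_feasible l u = {x.
     (\<forall>i\<in>index_I l u. - real (bound_m l u i) \<le> x $ i \<and> x $ i \<le> real (bound_m l u i)
        \<and> x $ i \<in> \<int>) \<and>
     (\<forall>i\<in>index_J l u. - real (bound_m l u i) \<le> x $ i \<and> x $ i \<le> real (bound_m l u i)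
        \<and> (x $ i - 1) / 2 \<in> \<int>)}"

(* The upper end (m - 1) div 2 is exact, since m is odd on J. *)
definition y_range :: "int ^ 'n \<Rightarrow> int ^ 'n \<Rightarrow> 'n \<Rightarrow> nat set" where
  "y_range l u i = (if i \<in> index_I l u then {1..bound_m l u i} else {0..(bound_m l u i - 1) div 2})"

(* Points are triples (x, y, z).  The doubly indexed family y only has entries y i k with
   k in y_range l u i; the extensional function space pins the remaining values. *)
type_synonym 'n mbqp_point = "(real ^ 'n) \<times> ('n \<Rightarrow> nat \<Rightarrow> real) \<times> (real ^ 'n)"

definition MBQP_obj ::
    "real ^ 'n ^ 'n \<Rightarrow> real ^ 'n \<Rightarrow> int ^ 'n \<Rightarrow> int ^ 'n \<Rightarrow> real ^ 'n \<Rightarrow> 'n mbqp_point \<Rightarrow> real" where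
  "MBQP_obj Q c l u \<theta> = (\<lambda>(x, y, z).
     quad_obj Q c x
     + (\<Sum>i\<in>index_I l u. \<theta> $ i * ((x $ i)\<^sup>2 - (\<Sum>k = 1..bound_m l u i. (real k)\<^sup>2 * y i k)))
     + (\<Sum>i\<in>index_J l u. \<theta> $ i *
          ((x $ i)\<^sup>2 - (\<Sum>k = 0..(bound_m l u i - 1) div 2. (real (2 * k + 1))\<^sup>2 * y i k))))"

definition MBQP_feasible :: "int ^ 'n \<Rightarrow> int ^ 'n \<Rightarrow> 'n mbqp_point set" where
  "MBQP_feasible l u = {(x, y, z).
     (\<forall>i. z $ i \<in> {0, 1}) \<and>
     (\<forall>i. y i \<in> y_range l u i \<rightarrow>\<^sub>E {0, 1}) \<and>
     (\<forall>i\<in>index_I l u.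
        - (\<Sum>k = 1..bound_m l u i. real k * y i k) \<le> x $ i \<and>
        x $ i \<le> (\<Sum>k = 1..bound_m l u i. real k * y i k) \<and>
        z $ i \<le> (\<Sum>k = 1..bound_m l u i. y i k) \<and>
        (\<Sum>k = 1..bound_m l u i. y i k) \<le> 1 \<and>
        (\<Sum>k = 1..bound_m l u i. real k * y i k) - x $ i \<le> 2 * real (bound_m l u i) * z $ i \<and>
        (\<Sum>k = 1..bound_m l u i. real k * y i k) + x $ i
          \<le> 2 * real (bound_m l u i) * (1 - z $ i)) \<and>
     (\<forall>i\<in>index_J l u.
        - (\<Sum>k = 0..(bound_m l u i - 1) div 2. real (2 * k + 1) * y i k) \<le> x $ i \<and>
        x $ i \<le> (\<Sum>k = 0..(bound_m l u i - 1) div 2. real (2 * k + 1) * y i k) \<and>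
        (\<Sum>k = 0..(bound_m l u i - 1) div 2. y i k) = 1 \<and>
        (\<Sum>k = 0..(bound_m l u i - 1) div 2. real (2 * k + 1) * y i k) - x $ i
          \<le> 2 * real (bound_m l u i) * z $ i \<and>
        (\<Sum>k = 0..(bound_m l u i - 1) div 2. real (2 * k + 1) * y i k) + x $ i
          \<le> 2 * real (bound_m l u i) * (1 - z $ i))}"

(* Taken in the extended reals: infinite for an infeasible problem, minus infinity for an
   unbounded one. *)
definition opt_value :: "('a \<Rightarrow> real) \<Rightarrow> 'a set \<Rightarrow> ereal" where
  "opt_value f S = (INF p\<in>S. ereal (f p))"

end

(* The binaries y i pick at most one of the admissible absolute values of x i, and z i picks its
   sign, so the constraints leave exactly one (y, z) above each feasible x of the original problem
   and nothing elsewhere.  Since y i has at most one nonzero entry, the square of x i is linear in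
   y i, and the terms weighted by \<theta> vanish on the feasible set. *)

theory Submission
  imports Defs
begin

text \<open>Both infima range over the same set of values, because \<open>\<pi>\<close> maps
  \<open>T\<close> onto \<open>S\<close> and preserves the objective. It is applied with
  \<open>\<pi>\<close> being \<open>fst\<close>, which forgets \<open>y\<close> and
  \<open>z\<close>.\<close>

lemma opt_value_lift:
  assumes "\<pi> ` T = S" and "\<And>p. p \<in> T \<Longrightarrow> g p = f (\<pi> p)"
  shows "opt_value f S = opt_value g T"
proof -
  have "opt_value f S = (INF p\<in>T. ereal (f (\<pi> p)))"
    unfolding opt_value_def assms(1)[symmetric] by (simp add: image_image)
  also have "\<dots> = opt_value g T"
    unfolding opt_value_def using assms(2) by (intro INF_cong) auto
  finally show ?thesis .
qed

text \<open>Competitors in \<open>S\<close> are the images of competitors in \<open>T\<close> with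
  the same objective value, so a point of \<open>T\<close> is minimal exactly when its image
  is.\<close>

lemma is_arg_min_lift:
  fixes f :: "'a \<Rightarrow> 'b::order"
  assumes "\<pi> ` T = S" and "\<And>p. p \<in> T \<Longrightarrow> g p = f (\<pi> p)"
  shows "is_arg_min f (\<lambda>x. x \<in> S) x \<longleftrightarrow> (\<exists>p. \<pi> p = x \<and> is_arg_min g (\<lambda>p. p \<in> T) p)"
  unfolding is_arg_min_def assms(1)[symmetric] using assms(2) by auto

text \<open>One entry equal to 1 exhausts the bound on the sum, so the remaining nonnegative entries
  sum to 0 and vanish.\<close>

lemma binary_sum_le_one_cases:
  fixes y :: "'a \<Rightarrow> real"
  assumes "finite A" "\<forall>k\<in>A. y k \<in> {0, 1}" "sum y A \<le> 1"
  obtains (zero) "\<And>k. k \<in> A \<Longrightarrow> y k = 0"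
    | (one) k where "k \<in> A" "y k = 1" "\<And>j. j \<in> A \<Longrightarrow> j \<noteq> k \<Longrightarrow> y j = 0"
proof (cases "\<exists>k\<in>A. y k = 1")
  case False
  then show ?thesis using assms(2) zero by blast
next
  case True
  then obtain k where k: "k \<in> A" "y k = 1" by blast
  have nonneg: "0 \<le> y j" if "j \<in> A" for j using assms(2) that by force
  have "sum y (A - {k}) \<le> 0"
    using assms(1,3) k by (simp add: sum_diff1)
  then have "sum y (A - {k}) = 0"
    using nonneg by (meson DiffD1 antisym sum_nonneg)
  then have "\<forall>j\<in>A - {k}. y j = 0"
    using assms(1) nonneg by (subst (asm) sum_nonneg_eq_0_iff) auto
  then show ?thesis using one k by blast
qed

lemma sum_mult_unit:
  fixes v y :: "'a \<Rightarrow> real"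
  assumes "finite A" "k \<in> A" "y k = 1" "\<And>j. j \<in> A \<Longrightarrow> j \<noteq> k \<Longrightarrow> y j = 0"
  shows "(\<Sum>j\<in>A. v j * y j) = v k"
proof -
  have "(\<Sum>j\<in>A. v j * y j) = (\<Sum>j\<in>A. if j = k then v j else 0)"
    using assms(3,4) by (intro sum.cong) auto
  then show ?thesis using assms(1,2) by simp
qed

text \<open>This treats a single coordinate for both index classes at once: the weights
  \<open>w k\<close> are \<open>k\<close> on \<open>index_I\<close> and \<open>2 * k + 1\<close> on
  \<open>index_J\<close>. The zero alternative records \<open>sum y A = 0\<close> so that an
  equality constraint on the sum can exclude it later.\<close>

lemma selection_decode:
  fixes w y :: "'a \<Rightarrow> real" and x z m :: real
  assumes A: "finite A" "\<forall>k\<in>A. y k \<in> {0, 1}" "sum y A \<le> 1"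
    and z: "z \<in> {0, 1}"
    and bounds: "- (\<Sum>k\<in>A. w k * y k) \<le> x" "x \<le> (\<Sum>k\<in>A. w k * y k)"
    and sign: "(\<Sum>k\<in>A. w k * y k) - x \<le> 2 * m * z"
      "(\<Sum>k\<in>A. w k * y k) + x \<le> 2 * m * (1 - z)"
  shows "x\<^sup>2 = (\<Sum>k\<in>A. (w k)\<^sup>2 * y k)"
    and "sum y A = 0 \<and> x = 0 \<or> (\<exists>k\<in>A. \<bar>x\<bar> = w k)"
proof -
  \<comment> \<open>For \<open>z = 0\<close> the first sign constraint gives
    \<open>x \<ge> \<Sum>\<close>, for \<open>z = 1\<close> the second gives
    \<open>x \<le> - \<Sum>\<close>; each meets the opposite bound. The two bounds together make the
    sum nonnegative.\<close>
  have abs_x: "\<bar>x\<bar> = (\<Sum>k\<in>A. w k * y k)"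
    using z bounds sign by auto
  have "x\<^sup>2 = (\<Sum>k\<in>A. (w k)\<^sup>2 * y k) \<and> (sum y A = 0 \<and> x = 0 \<or> (\<exists>k\<in>A. \<bar>x\<bar> = w k))"
    using A
  proof (cases rule: binary_sum_le_one_cases)
    case zero
    have "(\<Sum>k\<in>A. v k * y k) = 0" for v :: "'a \<Rightarrow> real"
      using zero by (simp add: sum.neutral)
    moreover have "sum y A = 0" using zero by (simp add: sum.neutral)
    ultimately show ?thesis using abs_x by simp
  next
    case (one k)
    \<comment> \<open>Kept general in \<open>v\<close> because it is used both for \<open>w\<close>,
      giving the absolute value of \<open>x\<close>, and for the squares of
      \<open>w\<close>.\<close>
    have "(\<Sum>j\<in>A. v j * y j) = v k" for v :: "'a \<Rightarrow> real"
      using A(1) one by (rule sum_mult_unit)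
    then show ?thesis using abs_x one(1) by (metis power2_abs)
  qed
  then show "x\<^sup>2 = (\<Sum>k\<in>A. (w k)\<^sup>2 * y k)"
    and "sum y A = 0 \<and> x = 0 \<or> (\<exists>k\<in>A. \<bar>x\<bar> = w k)" by auto
qed

text \<open>The inverse of the decoding above: it marks the index whose weight is the absolute value
  of \<open>x\<close>. The restriction to \<open>A\<close> matches the extensional function space in
  \<open>MBQP_feasible\<close>.\<close>

definition select_y :: "'a set \<Rightarrow> ('a \<Rightarrow> real) \<Rightarrow> real \<Rightarrow> 'a \<Rightarrow> real" where
  "select_y A w x = (\<lambda>k\<in>A. if w k = \<bar>x\<bar> then 1 else 0)"

lemma select_y_funcset: "select_y A w x \<in> A \<rightarrow>\<^sub>E {0, 1}"
  by (auto simp: select_y_def)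

lemma select_y_absent:
  assumes "\<bar>x\<bar> \<notin> w ` A"
  shows "k \<in> A \<Longrightarrow> select_y A w x k = 0"
  using assms by (force simp: select_y_def)

text \<open>Injectivity of \<open>w\<close> makes \<open>k\<close> the only marked index, so
  \<open>select_y\<close> is a unit vector on \<open>A\<close>.\<close>

lemma sum_select_y:
  assumes "finite A" "inj_on w A" "k \<in> A" "\<bar>x\<bar> = w k"
  shows "sum (select_y A w x) A = 1" "(\<Sum>j\<in>A. w j * select_y A w x j) = \<bar>x\<bar>"
proof -
  have unit: "select_y A w x k = 1" "\<And>j. j \<in> A \<Longrightarrow> j \<noteq> k \<Longrightarrow> select_y A w x j = 0"
    using assms(2-4) by (auto simp: select_y_def inj_on_def)
  have *: "(\<Sum>j\<in>A. v j * select_y A w x j) = v k" for v :: "'a \<Rightarrow> real"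
    using assms(1,3) unit by (rule sum_mult_unit)
  show "sum (select_y A w x) A = 1" using *[of "\<lambda>_. 1"] by simp
  show "(\<Sum>j\<in>A. w j * select_y A w x j) = \<bar>x\<bar>" using *[of w] assms(4) by simp
qed

lemma index_J_eq: "index_J l u = - index_I l u"
  by (auto simp: index_I_def index_J_def)

lemma MBQP_feasibleD:
  assumes lu: "\<forall>i. l $ i < u $ i" and feas: "(x, y, z) \<in> MBQP_feasible l u"
  shows "x \<in> P_feasible l u" and "MBQP_obj Q c l u \<theta> (x, y, z) = quad_obj Q c x"
proof -
  have z: "z $ i \<in> {0, 1}" and y: "y i \<in> y_range l u i \<rightarrow>\<^sub>E {0, 1}" for i
    using feas by (auto simp: MBQP_feasible_def)
  have I: "(x $ i)\<^sup>2 = (\<Sum>k = 1..bound_m l u i. (real k)\<^sup>2 * y i k)"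
    "x $ i = 0 \<or> (\<exists>k\<in>{1..bound_m l u i}. \<bar>x $ i\<bar> = real k)"
    if "i \<in> index_I l u" for i
  proof -
    have "\<forall>k\<in>{1..bound_m l u i}. y i k \<in> {0, 1}"
      using y[of i] that by (auto simp: y_range_def PiE_iff)
    note * = selection_decode[of "{1..bound_m l u i}" "y i" "z $ i" real "x $ i"
        "real (bound_m l u i)", OF finite_atLeastAtMost this _ z]
    show "(x $ i)\<^sup>2 = (\<Sum>k = 1..bound_m l u i. (real k)\<^sup>2 * y i k)"
      using feas that by (intro *(1)) (auto simp: MBQP_feasible_def)
    have "sum (y i) {1..bound_m l u i} = 0 \<and> x $ i = 0
        \<or> (\<exists>k\<in>{1..bound_m l u i}. \<bar>x $ i\<bar> = real k)"
      using feas that by (intro *(2)) (auto simp: MBQP_feasible_def)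
    then show "x $ i = 0 \<or> (\<exists>k\<in>{1..bound_m l u i}. \<bar>x $ i\<bar> = real k)" by blast
  qed
  have J: "(x $ i)\<^sup>2 = (\<Sum>k = 0..(bound_m l u i - 1) div 2. (real (2 * k + 1))\<^sup>2 * y i k)"
    "\<exists>k\<in>{0..(bound_m l u i - 1) div 2}. \<bar>x $ i\<bar> = real (2 * k + 1)"
    if "i \<in> index_J l u" for i
  proof -
    let ?A = "{0..(bound_m l u i - 1) div 2}"
    have "\<forall>k\<in>?A. y i k \<in> {0, 1}"
      using y[of i] that unfolding y_range_def index_J_eq PiE_iff by auto
    note * = selection_decode[of ?A "y i" "z $ i" "\<lambda>k. real (2 * k + 1)" "x $ i"
        "real (bound_m l u i)", OF finite_atLeastAtMost this _ z]
    have constr: "- (\<Sum>k\<in>?A. real (2 * k + 1) * y i k) \<le> x $ i"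
      "x $ i \<le> (\<Sum>k\<in>?A. real (2 * k + 1) * y i k)"
      "sum (y i) ?A = 1"
      "(\<Sum>k\<in>?A. real (2 * k + 1) * y i k) - x $ i \<le> 2 * real (bound_m l u i) * z $ i"
      "(\<Sum>k\<in>?A. real (2 * k + 1) * y i k) + x $ i \<le> 2 * real (bound_m l u i) * (1 - z $ i)"
      using feas that unfolding MBQP_feasible_def by blast+
    show "(x $ i)\<^sup>2 = (\<Sum>k\<in>?A. (real (2 * k + 1))\<^sup>2 * y i k)"
      using constr by (intro *(1)) simp_all
    have "sum (y i) ?A = 0 \<and> x $ i = 0 \<or> (\<exists>k\<in>?A. \<bar>x $ i\<bar> = real (2 * k + 1))"
      using constr by (intro *(2)) simp_all
    \<comment> \<open>On \<open>index_J\<close> the entries sum to exactly 1, which rules out the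
      zero alternative.\<close>
    then show "\<exists>k\<in>?A. \<bar>x $ i\<bar> = real (2 * k + 1)"
      using constr(3) by simp
  qed
  show "MBQP_obj Q c l u \<theta> (x, y, z) = quad_obj Q c x"
    unfolding MBQP_obj_def using I(1) J(1) by simp
  have "- real (bound_m l u i) \<le> x $ i \<and> x $ i \<le> real (bound_m l u i) \<and> x $ i \<in> \<int>"
    if i: "i \<in> index_I l u" for i
    using I(2)[OF i]
  proof
    assume "\<exists>k\<in>{1..bound_m l u i}. \<bar>x $ i\<bar> = real k"
    then obtain k where k: "k \<le> bound_m l u i" "\<bar>x $ i\<bar> = real k" by auto
    then have "x $ i = real k \<or> x $ i = - real k" by linarith
    then show ?thesis using k by auto
  qed simp
  moreover have "- real (bound_m l u i) \<le> x $ i \<and> x $ i \<le> real (bound_m l u i)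
      \<and> (x $ i - 1) / 2 \<in> \<int>"
    if i: "i \<in> index_J l u" for i
  proof -
    obtain k where k: "k \<le> (bound_m l u i - 1) div 2" "\<bar>x $ i\<bar> = real (2 * k + 1)"
      using J(2)[OF i] by auto
    \<comment> \<open>Oddness makes the truncated subtraction and the division in the upper end
      exact, so the largest weight is \<open>bound_m l u i\<close> itself.\<close>
    have "odd (bound_m l u i)" using lu i by (simp add: bound_m_J)
    with k(1) have "2 * k + 1 \<le> bound_m l u i" by presburger
    then have "\<bar>x $ i\<bar> \<le> real (bound_m l u i)" using k(2) by linarith
    \<comment> \<open>The two cases are \<open>x $ i = 2 * k + 1\<close> and
      \<open>x $ i = - (2 * k + 1)\<close>.\<close>
    moreover have "(x $ i - 1) / 2 = real k \<or> (x $ i - 1) / 2 = - real k - 1"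
      using k(2) by (auto simp: abs_if split: if_splits)
    then have "(x $ i - 1) / 2 \<in> \<int>"
      by (elim disjE) (simp_all only: Ints_diff Ints_minus Ints_of_nat Ints_1)
    ultimately show ?thesis by (auto simp: abs_le_iff)
  qed
  ultimately show "x \<in> P_feasible l u" by (auto simp: P_feasible_def)
qed

lemma P_feasible_lift:
  assumes lu: "\<forall>i. l $ i < u $ i" and feas: "x \<in> P_feasible l u"
  shows "\<exists>y z. (x, y, z) \<in> MBQP_feasible l u"
proof -
  define w :: "'a \<Rightarrow> nat \<Rightarrow> real" where
    "w i k = (if i \<in> index_I l u then real k else real (2 * k + 1))" for i k
  define y where "y i = select_y (y_range l u i) (w i) (x $ i)" for i
  \<comment> \<open>The strict inequality matters at \<open>x $ i = 0\<close> with \<open>i\<close>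
    in \<open>index_I\<close>: there no entry of \<open>y i\<close> is selected, and
    \<open>z $ i \<le> \<Sum> y i\<close> forces \<open>z $ i = 0\<close>.\<close>
  define z :: "real ^ 'a" where "z = (\<chi> i. if x $ i < 0 then 1 else 0)"
  have fin: "finite (y_range l u i)" for i by (simp add: y_range_def)
  have inj: "inj_on (w i) (y_range l u i)" for i by (auto simp: w_def inj_on_def)
  have bound: "\<bar>x $ i\<bar> \<le> real (bound_m l u i)" for i
    using feas by (cases "i \<in> index_I l u") (force simp: P_feasible_def index_J_eq abs_le_iff)+
  have I: "z $ i \<le> (\<Sum>k\<in>{1..bound_m l u i}. y i k)" "(\<Sum>k\<in>{1..bound_m l u i}. y i k) \<le> 1"
      "(\<Sum>k\<in>{1..bound_m l u i}. real k * y i k) = \<bar>x $ i\<bar>"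
    if i: "i \<in> index_I l u" for i
  proof -
    have A: "y_range l u i = {1..bound_m l u i}" and w: "w i = real"
      using i by (auto simp: y_range_def w_def)
    have "z $ i \<le> sum (y i) {1..bound_m l u i} \<and> sum (y i) {1..bound_m l u i} \<le> 1
      \<and> (\<Sum>k\<in>{1..bound_m l u i}. real k * y i k) = \<bar>x $ i\<bar>"
    proof (cases "x $ i = 0")
      case True
      \<comment> \<open>The weights on \<open>index_I\<close> start at 1, so 0 is represented by
        selecting nothing.\<close>
      then have "y i k = 0" if "k \<in> {1..bound_m l u i}" for k
        using that unfolding y_def A w by (intro select_y_absent) auto
      then show ?thesis using True by (simp add: z_def)
    next
      case False
      have "x $ i \<in> \<int>" using feas i by (auto simp: P_feasible_def)
      then obtain a where a: "x $ i = of_int a" by (rule Ints_cases)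
      then have "\<bar>x $ i\<bar> = real (nat \<bar>a\<bar>)" by simp
      moreover from this have "nat \<bar>a\<bar> \<in> {1..bound_m l u i}"
        using bound[of i] False a by auto
      ultimately show ?thesis
        using sum_select_y[OF fin inj, of "nat \<bar>a\<bar>" i "x $ i"]
        unfolding A w y_def by (simp add: z_def)
    qed
    then show "z $ i \<le> (\<Sum>k\<in>{1..bound_m l u i}. y i k)" "(\<Sum>k\<in>{1..bound_m l u i}. y i k) \<le> 1"
      "(\<Sum>k\<in>{1..bound_m l u i}. real k * y i k) = \<bar>x $ i\<bar>" by auto
  qed
  have J: "(\<Sum>k\<in>{0..(bound_m l u i - 1) div 2}. y i k) = 1"
      "(\<Sum>k\<in>{0..(bound_m l u i - 1) div 2}. real (2 * k + 1) * y i k) = \<bar>x $ i\<bar>"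
    if i: "i \<in> index_J l u" for i
  proof -
    have A: "y_range l u i = {0..(bound_m l u i - 1) div 2}" and w: "w i = (\<lambda>k. real (2 * k + 1))"
      using i by (auto simp: y_range_def w_def index_J_eq)
    have "(x $ i - 1) / 2 \<in> \<int>" using feas i by (auto simp: P_feasible_def)
    then obtain a where "(x $ i - 1) / 2 = of_int a" by (rule Ints_cases)
    then have a: "x $ i = of_int (2 * a + 1)" by simp
    \<comment> \<open>For negative \<open>a\<close>,
      \<open>- (2 * a + 1) = 2 * (- a - 1) + 1\<close>, so this \<open>k\<close> indexes the odd
      number that is the absolute value of \<open>x $ i\<close>.\<close>
    define k where "k = nat (if 0 \<le> a then a else - a - 1)"
    have "\<bar>2 * a + 1\<bar> = int (2 * k + 1)" by (auto simp: k_def)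
    then have "\<bar>x $ i\<bar> = of_int (int (2 * k + 1))" using a by (metis of_int_abs)
    then have xk: "\<bar>x $ i\<bar> = real (2 * k + 1)" by simp
    then have "2 * k + 1 \<le> bound_m l u i" using bound[of i] by linarith
    then have "k \<in> {0..(bound_m l u i - 1) div 2}" by auto
    then show "(\<Sum>k\<in>{0..(bound_m l u i - 1) div 2}. y i k) = 1"
      "(\<Sum>k\<in>{0..(bound_m l u i - 1) div 2}. real (2 * k + 1) * y i k) = \<bar>x $ i\<bar>"
      using sum_select_y[OF fin inj, of k i "x $ i"] xk unfolding A w y_def by blast+
  qed
  \<comment> \<open>Of the two left-hand sides one is 0 and the other is twice the absolute value of
    \<open>x $ i\<close>. The choice of \<open>z\<close> pairs the latter with the right-hand side
    \<open>2 * bound_m l u i\<close>.\<close>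
  have sign: "\<bar>x $ i\<bar> - x $ i \<le> 2 * real (bound_m l u i) * z $ i"
    "\<bar>x $ i\<bar> + x $ i \<le> 2 * real (bound_m l u i) * (1 - z $ i)" for i
    using bound[of i] by (auto simp: z_def)
  have "z $ i \<in> {0, 1}" for i by (simp add: z_def)
  moreover have "y i \<in> y_range l u i \<rightarrow>\<^sub>E {0, 1}" for i
    unfolding y_def by (rule select_y_funcset)
  moreover have "- \<bar>x $ i\<bar> \<le> x $ i" "x $ i \<le> \<bar>x $ i\<bar>" for i by linarith+
  ultimately have "(x, y, z) \<in> MBQP_feasible l u"
    unfolding MBQP_feasible_def mem_Collect_eq prod.case
    using I J sign by (intro conjI allI ballI) (simp_all only: order_refl)
  then show ?thesis by blast
qed

theorem theorem1:
  fixes Q :: "real ^ 'n ^ 'n" and c \<theta> :: "real ^ 'n" and l u :: "int ^ 'n"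
  assumes "\<forall>i. l $ i < u $ i"
  shows "opt_value (quad_obj Q c) (P_feasible l u)
           = opt_value (MBQP_obj Q c l u \<theta>) (MBQP_feasible l u) \<and>
         (\<forall>x. is_arg_min (quad_obj Q c) (\<lambda>x. x \<in> P_feasible l u) x \<longleftrightarrow>
           (\<exists>y z. is_arg_min (MBQP_obj Q c l u \<theta>) (\<lambda>p. p \<in> MBQP_feasible l u) (x, y, z)))"
proof -
  have "fst ` MBQP_feasible l u = P_feasible l u"
    using MBQP_feasibleD(1)[OF assms] P_feasible_lift[OF assms] by force
  moreover have "MBQP_obj Q c l u \<theta> p = quad_obj Q c (fst p)" if "p \<in> MBQP_feasible l u" for p
    using MBQP_feasibleD(2)[OF assms] that by (cases p) auto
  ultimately show ?thesis
    using opt_value_lift[of fst "MBQP_feasible l u" "P_feasible l u"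
        "MBQP_obj Q c l u \<theta>" "quad_obj Q c"]
      is_arg_min_lift[of fst "MBQP_feasible l u" "P_feasible l u"
        "MBQP_obj Q c l u \<theta>" "quad_obj Q c"]
    by simp
qed

end
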